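(* Let $0<q<1$ and $\alpha\ge0$, and put $\gamma=\alpha/(1-q)$. Then, for every $x\in[0,1]$ and every $m=0,1,2,\dots$, $$S_\infty^{q,\alpha}(e_m;x)=\sum_{s=0}^{m}\binom{m}{s}(-1)^s\,\frac{\left(\frac{x+\gamma}{1+\gamma};q\right)_s}{\left(\frac{\gamma}{1+\gamma};q\right)_s}.$$
   Context: Write $e_m(t)=t^m$. The $q$-Pochhammer symbols are $(a;q)_0=1$, $(a;q)_m=\prod_{j=0}^{m-1}(1-aq^j)$, $(a;q)_\infty=\prod_{j=0}^\infty(1-aq^j)$. Empty products equal $1$ and $0^0=1$. For $k\in\mathbb{N}_0$ and $x\in[0,1]$ let $$p_{\infty k}^{q,\alpha}(x)=\frac{\left(\frac{\gamma}{x+\gamma};q\right)_k\left(\frac{x+\gamma}{1+\gamma};q\right)_\infty\left(\frac{x+\gamma}{1+\gamma}\right)^k}{(q;q)_k\left(\frac{\gamma}{1+\gamma};q\right)_\infty},\qquad \gamma=\frac{\alpha}{1-q},$$ where the product $\left(\frac{\gamma}{x+\gamma};q\right)_k\left(\frac{x+\gamma}{1+\gamma}\right)^k$ is read as $(1+\gamma)^{-k}\prod_{i=0}^{k-1}(x+\gamma-\gamma q^i)$ (relevant only when $x=\gamma=0$). The limit $q$-Stancu operator on $f\in C[0,1]$ is $$S_\infty^{q,\alpha}(f;x)=\sum_{k=0}^\infty f(1-q^k)\,p_{\infty k}^{q,\alpha}(x)\ \text{ for } x\in[0,1),\qquad S_\infty^{q,\alpha}(f;1)=f(1).$$ *)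

theory Defs
  imports "HOL-Analysis.Analysis"
begin

definition q_pochhammer :: "real \<Rightarrow> real \<Rightarrow> nat \<Rightarrow> real" where
  "q_pochhammer a q m = (\<Prod>j<m. 1 - a * q ^ j)"

definition q_pochhammer_inf :: "real \<Rightarrow> real \<Rightarrow> real" where
  "q_pochhammer_inf a q = (\<Prod>j. 1 - a * q ^ j)"

text \<open>
  The basis functions are usually displayed with the factor
  \<open>q_pochhammer (\<gamma> / (x + \<gamma>)) q k * ((x + \<gamma>) / (1 + \<gamma>)) ^ k\<close>, which is meaningless for
  \<open>x = \<gamma> = 0\<close>. The definition uses the product obtained by cancelling \<open>x + \<gamma>\<close>;
  see \<open>stancu_basis_eq\<close> below for the displayed form.
\<close>

definition stancu_basis :: "real \<Rightarrow> real \<Rightarrow> nat \<Rightarrow> real \<Rightarrow> real" where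
  "stancu_basis q \<alpha> k x = (let \<gamma> = \<alpha> / (1 - q) in
     ((\<Prod>i<k. x + \<gamma> - \<gamma> * q ^ i) / (1 + \<gamma>) ^ k) * q_pochhammer_inf ((x + \<gamma>) / (1 + \<gamma>)) q
     / (q_pochhammer q q k * q_pochhammer_inf (\<gamma> / (1 + \<gamma>)) q))"

text \<open>
  Only the values of \<open>f\<close> on \<open>{0..1}\<close> enter, and only \<open>x \<in> {0..1}\<close> is meant.
\<close>

definition limit_q_stancu :: "real \<Rightarrow> real \<Rightarrow> (real \<Rightarrow> real) \<Rightarrow> real \<Rightarrow> real" where
  "limit_q_stancu q \<alpha> f x =
     (if x = 1 then f 1 else (\<Sum>k. f (1 - q ^ k) * stancu_basis q \<alpha> k x))"

lemma stancu_basis_eq: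
  assumes "\<gamma> = \<alpha> / (1 - q)" "x + \<gamma> \<noteq> 0"
  shows "stancu_basis q \<alpha> k x =
    q_pochhammer (\<gamma> / (x + \<gamma>)) q k * q_pochhammer_inf ((x + \<gamma>) / (1 + \<gamma>)) q
      * ((x + \<gamma>) / (1 + \<gamma>)) ^ k
    / (q_pochhammer q q k * q_pochhammer_inf (\<gamma> / (1 + \<gamma>)) q)"
proof -
  have "(\<Prod>i<k. x + \<gamma> - \<gamma> * q ^ i) = (\<Prod>i<k. (x + \<gamma>) * (1 - \<gamma> / (x + \<gamma>) * q ^ i))"
    using assms(2) by (intro prod.cong) (auto simp: field_simps)
  also have "\<dots> = (x + \<gamma>) ^ k * q_pochhammer (\<gamma> / (x + \<gamma>)) q k"
    by (simp add: prod.distrib q_pochhammer_def)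
  finally show ?thesis
    using assms(1) by (simp add: stancu_basis_def Let_def power_divide)
qed

text \<open>
  The infinite products and the series above converge, so that the library's \<open>prodinf\<close> and
  \<open>suminf\<close> denote the intended values. (\<open>has_prod\<close> admits finitely many zero factors.)
\<close>

lemma convergent_prod_q_pochhammer:
  fixes a q :: real
  assumes "0 < q" "q < 1"
  shows "convergent_prod (\<lambda>j. 1 - a * q ^ j)"
proof -
  have "summable (\<lambda>j. norm (- a * q ^ j))"
    using assms by (auto simp: abs_mult intro!: summable_mult)
  then have "abs_convergent_prod (\<lambda>j. 1 + (- a * q ^ j))"
    by (intro summable_imp_abs_convergent_prod) (simp add: abs_mult)
  then show ?thesis
    using abs_convergent_prod_imp_convergent_prod by force
qed

lemma summable_limit_q_stancu:
  assumes q: "0 < q" "q < 1" and "0 \<le> \<alpha>" and x: "0 \<le> x" "x < 1"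
    and f: "continuous_on {0..1} f"
  shows "summable (\<lambda>k. f (1 - q ^ k) * stancu_basis q \<alpha> k x)"
proof -
  define \<gamma> where "\<gamma> = \<alpha> / (1 - q)"
  define r where "r = (x + \<gamma>) / (1 + \<gamma>)"
  define C where "C = \<bar>q_pochhammer_inf r q\<bar> / \<bar>q_pochhammer_inf (\<gamma> / (1 + \<gamma>)) q\<bar>"
  have \<gamma>: "\<gamma> \<ge> 0" using assms by (simp add: \<gamma>_def)
  have r: "0 \<le> r" "r < 1" using \<gamma> x by (simp_all add: r_def)
  have C: "C \<ge> 0" by (simp add: C_def)
  have "bounded (f ` {0..1})"
    by (intro compact_imp_bounded compact_continuous_image f compact_Icc)
  then obtain B where B: "\<And>t. t \<in> {0..1} \<Longrightarrow> \<bar>f t\<bar> \<le> B"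
    unfolding bounded_iff real_norm_def by blast
  have B0: "B \<ge> 0" using B[of 0] by auto
  have pos: "q_pochhammer q q k > 0" for k
    unfolding q_pochhammer_def
  proof (intro prod_pos)
    fix j show "0 < 1 - q * q ^ j" using q power_Suc_less_one[of q j] by simp
  qed
  have nz: "1 - q * q ^ j \<noteq> 0" for j using q power_Suc_less_one[of q j] by simp
  have lim: "(\<lambda>k. q_pochhammer q q k) \<longlonglongrightarrow> q_pochhammer_inf q q"
    unfolding q_pochhammer_def q_pochhammer_inf_def
    using convergent_prod_LIMSEQ[OF convergent_prod_q_pochhammer[OF q, of q]]
    by (simp add: LIMSEQ_lessThan_iff_atMost)
  have "q_pochhammer_inf q q \<noteq> 0"
    unfolding q_pochhammer_inf_def
    using prodinf_nonzero[OF convergent_prod_q_pochhammer[OF q, of q]] nz by blast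
  then have "(\<lambda>k. inverse (q_pochhammer q q k)) \<longlonglongrightarrow> inverse (q_pochhammer_inf q q)"
    using lim by (intro tendsto_inverse)
  then obtain D where D: "\<And>k. \<bar>inverse (q_pochhammer q q k)\<bar> \<le> D"
    by (metis convergentI convergent_imp_Bseq BseqE real_norm_def)
  have D0: "D \<ge> 0" using D[of 0] by linarith
  have num: "\<bar>(\<Prod>i<k. x + \<gamma> - \<gamma> * q ^ i) / (1 + \<gamma>) ^ k\<bar> \<le> r ^ k" for k
  proof -
    have fac: "0 \<le> x + \<gamma> - \<gamma> * q ^ i \<and> x + \<gamma> - \<gamma> * q ^ i \<le> x + \<gamma>" for i
    proof -
      have "\<gamma> * q ^ i \<le> \<gamma>" using \<gamma> q by (simp add: mult_left_le power_le_one)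
      moreover have "0 \<le> \<gamma> * q ^ i" using \<gamma> q by simp
      ultimately show ?thesis using x by linarith
    qed
    have "(\<Prod>i<k. x + \<gamma> - \<gamma> * q ^ i) \<le> (\<Prod>i<k. x + \<gamma>)"
      using fac by (intro prod_mono) blast
    moreover have "0 \<le> (\<Prod>i<k. x + \<gamma> - \<gamma> * q ^ i)"
      using fac by (intro prod_nonneg) blast
    ultimately show ?thesis
      using \<gamma> by (simp add: r_def power_divide divide_right_mono)
  qed
  have bound: "norm (f (1 - q ^ k) * stancu_basis q \<alpha> k x) \<le> B * (C * D) * r ^ k" for k
  proof -
    have "\<bar>stancu_basis q \<alpha> k x\<bar> =
      \<bar>(\<Prod>i<k. x + \<gamma> - \<gamma> * q ^ i) / (1 + \<gamma>) ^ k\<bar> * (C * \<bar>inverse (q_pochhammer q q k)\<bar>)"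
      unfolding stancu_basis_def Let_def \<gamma>_def[symmetric] r_def[symmetric] C_def
      by (simp add: abs_mult divide_inverse)
    also have "\<dots> \<le> r ^ k * (C * D)"
      using num D C r by (intro mult_mono mult_nonneg_nonneg order_refl) auto
    finally have "\<bar>stancu_basis q \<alpha> k x\<bar> \<le> r ^ k * (C * D)" .
    moreover have "\<bar>f (1 - q ^ k)\<bar> \<le> B"
      using q by (intro B) (auto simp: power_le_one)
    ultimately have "\<bar>f (1 - q ^ k)\<bar> * \<bar>stancu_basis q \<alpha> k x\<bar> \<le> B * (r ^ k * (C * D))"
      using B0 by (intro mult_mono) auto
    then show ?thesis by (simp add: abs_mult mult_ac)
  qed
  have "summable (\<lambda>k. B * (C * D) * r ^ k)"
    using r by (intro summable_mult summable_geometric) auto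
  then show ?thesis
    using bound by (rule summable_comparison_test'[where N = 0])
qed

end

theory Submission
  imports Defs
begin

text \<open>
  Put \<open>u = (x + \<gamma>) / (1 + \<gamma>)\<close>, \<open>c = \<gamma> / (1 + \<gamma>)\<close>. Up to the factor \<open>(u;q)\<^sub>\<infinity> / (c;q)\<^sub>\<infinity>\<close>, which does not
  depend on \<open>k\<close>, the basis function with index \<open>k\<close> is the coefficient of \<open>z\<^sup>k\<close> in
  \<open>F(z) = (\<Sum>k. (\<Prod>i<k. u - c * q ^ i) / (q;q)\<^sub>k * z ^ k)\<close>. The ratio of consecutive coefficients
  makes \<open>F\<close> satisfy \<open>(1 - u * z) * F(z) = (1 - c * z) * F(q * z)\<close>
  (\<open>q_binomial_series_functional_eq\<close>). Iterating this from \<open>z = 1\<close> gives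
  \<open>(u;q)\<^sub>s * F(1) = (c;q)\<^sub>s * F(q\<^sup>s)\<close>, and since \<open>F(q\<^sup>s)\<close> tends to \<open>F(0) = 1\<close>, also
  \<open>F(1) = (c;q)\<^sub>\<infinity> / (u;q)\<^sub>\<infinity>\<close>, which is the \<open>q\<close>-binomial theorem.

  Consequently the basis functions are the coefficients of \<open>F(z) / F(1)\<close>, and the operator maps the
  function with values \<open>q ^ (s * k)\<close> at the nodes \<open>1 - q ^ k\<close>, that is \<open>t \<mapsto> (1 - t) ^ s\<close>, to
  \<open>F(q\<^sup>s) / F(1) = (u;q)\<^sub>s / (c;q)\<^sub>s\<close>. The theorem follows by expanding \<open>t ^ m\<close> in powers of
  \<open>1 - t\<close>. At the endpoint \<open>x = 1\<close>, where \<open>u = 1\<close> and the series need not converge, both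
  sides equal \<open>1\<close>, because \<open>(1;q)\<^sub>s\<close> vanishes for \<open>s > 0\<close>.
\<close>

lemma q_pochhammer_0 [simp]: "q_pochhammer a q 0 = 1"
  by (simp add: q_pochhammer_def)

lemma q_pochhammer_Suc: "q_pochhammer a q (Suc n) = q_pochhammer a q n * (1 - a * q ^ n)"
  by (simp add: q_pochhammer_def)

lemma q_pochhammer_one_left: "s > 0 \<Longrightarrow> q_pochhammer 1 q s = 0"
  by (auto simp: q_pochhammer_def intro!: bexI[of _ 0])

lemma q_pochhammer_factor_pos:
  fixes a q :: real
  assumes "0 < q" "q < 1" "a < 1"
  shows "0 < 1 - a * q ^ j"
proof (cases "a \<le> 0")
  case True
  then have "a * q ^ j \<le> 0"
    using assms by (simp add: mult_nonpos_nonneg)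
  then show ?thesis by simp
next
  case False
  then have "a * q ^ j \<le> a"
    using assms by (simp add: mult_left_le power_le_one)
  then show ?thesis using assms by simp
qed

lemma q_pochhammer_pos: "0 < q \<Longrightarrow> q < 1 \<Longrightarrow> a < 1 \<Longrightarrow> 0 < q_pochhammer a q n"
  unfolding q_pochhammer_def by (intro prod_pos) (rule q_pochhammer_factor_pos)

lemma q_pochhammer_LIMSEQ:
  assumes "0 < q" "q < 1"
  shows "q_pochhammer a q \<longlonglongrightarrow> q_pochhammer_inf a q"
  unfolding q_pochhammer_def q_pochhammer_inf_def
  using convergent_prod_LIMSEQ[OF convergent_prod_q_pochhammer[OF assms, of a]]
  by (simp add: LIMSEQ_lessThan_iff_atMost)

lemma q_pochhammer_inf_nonzero:
  assumes "0 < q" "q < 1" "a < 1"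
  shows "q_pochhammer_inf a q \<noteq> 0"
  unfolding q_pochhammer_inf_def
  using prodinf_nonzero[OF convergent_prod_q_pochhammer[OF assms(1,2), of a]]
    q_pochhammer_factor_pos[OF assms] by (metis less_irrefl)

text \<open>
  For \<open>u \<noteq> 0\<close> this is \<open>(c/u;q)\<^sub>k * u ^ k / (q;q)\<^sub>k\<close>, the coefficient in the \<open>q\<close>-binomial series
  with parameter \<open>c/u\<close> and argument \<open>u * z\<close>; this form has no exceptional case at \<open>u = 0\<close>.
\<close>
definition q_binomial_coeff :: "real \<Rightarrow> real \<Rightarrow> real \<Rightarrow> nat \<Rightarrow> real" where
  "q_binomial_coeff q u c k = (\<Prod>i<k. u - c * q ^ i) / q_pochhammer q q k"

definition q_binomial_series :: "real \<Rightarrow> real \<Rightarrow> real \<Rightarrow> real \<Rightarrow> real" where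
  "q_binomial_series q u c z = (\<Sum>k. q_binomial_coeff q u c k * z ^ k)"

lemma q_binomial_coeff_0 [simp]: "q_binomial_coeff q u c 0 = 1"
  by (simp add: q_binomial_coeff_def)

lemma q_binomial_coeff_Suc:
  assumes "0 < q" "q < 1"
  shows "q_binomial_coeff q u c (Suc k) * (1 - q ^ Suc k) = (u - c * q ^ k) * q_binomial_coeff q u c k"
  using q_pochhammer_factor_pos[OF assms assms(2), of k] q_pochhammer_pos[OF assms assms(2), of k]
  by (simp add: q_binomial_coeff_def q_pochhammer_Suc field_simps)

text \<open>The ratio of consecutive terms tends to \<open>u * z\<close>, so the ratio test applies.\<close>
lemma summable_q_binomial_series:
  assumes q: "0 < q" "q < 1" and "\<bar>u * z\<bar> < 1"
  shows "summable (\<lambda>k. q_binomial_coeff q u c k * z ^ k)"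
proof -
  define \<rho> where "\<rho> k = (u - c * q ^ k) / (1 - q ^ Suc k) * z" for k
  have qk: "(\<lambda>k. q ^ k) \<longlonglongrightarrow> 0"
    using q by (intro LIMSEQ_power_zero) auto
  have "(\<lambda>k. \<bar>\<rho> k\<bar>) \<longlonglongrightarrow> \<bar>(u - c * 0) / (1 - 0) * z\<bar>"
    unfolding \<rho>_def using LIMSEQ_Suc[OF qk] by (intro tendsto_intros qk) auto
  moreover obtain C where C: "\<bar>u * z\<bar> < C" "C < 1"
    using dense assms(3) by blast
  ultimately have "eventually (\<lambda>k. \<bar>\<rho> k\<bar> < C) sequentially"
    by (auto intro: order_tendstoD)
  then obtain N where N: "\<And>k. k \<ge> N \<Longrightarrow> \<bar>\<rho> k\<bar> < C"
    by (auto simp: eventually_sequentially)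
  have step: "q_binomial_coeff q u c (Suc k) * z ^ Suc k = \<rho> k * (q_binomial_coeff q u c k * z ^ k)" for k
  proof -
    have "1 - q ^ Suc k \<noteq> 0"
      using q_pochhammer_factor_pos[OF q q(2), of k] by simp
    then have "q_binomial_coeff q u c (Suc k) = (u - c * q ^ k) / (1 - q ^ Suc k) * q_binomial_coeff q u c k"
      using q_binomial_coeff_Suc[OF q, of u c k] by (metis nonzero_eq_divide_eq times_divide_eq_left)
    then show ?thesis by (simp add: \<rho>_def)
  qed
  show ?thesis
  proof (rule summable_ratio_test[OF C(2), of N])
    fix k assume "k \<ge> N"
    then show "norm (q_binomial_coeff q u c (Suc k) * z ^ Suc k) \<le> C * norm (q_binomial_coeff q u c k * z ^ k)"
      unfolding step norm_mult[of "\<rho> k"] using N[of k] by (intro mult_right_mono) auto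
  qed
qed

text \<open>
  Comparing coefficients of \<open>z ^ (k + 1)\<close> on both sides reduces this to \<open>q_binomial_coeff_Suc\<close>.
\<close>
lemma q_binomial_series_functional_eq:
  assumes q: "0 < q" "q < 1" and z: "\<bar>u * z\<bar> < 1"
  shows "(1 - u * z) * q_binomial_series q u c z = (1 - c * z) * q_binomial_series q u c (q * z)"
proof -
  let ?a = "q_binomial_coeff q u c" and ?F = "q_binomial_series q u c"
  have "\<bar>u * (q * z)\<bar> = q * \<bar>u * z\<bar>"
    using q by (simp add: abs_mult)
  also have "\<dots> \<le> \<bar>u * z\<bar>"
    using q by (simp add: mult_left_le_one_le)
  finally have qz: "\<bar>u * (q * z)\<bar> < 1" using z by simp
  have F: "(\<lambda>k. ?a k * z ^ k) sums ?F z"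
    unfolding q_binomial_series_def by (rule summable_sums[OF summable_q_binomial_series[OF q z]])
  have G: "(\<lambda>k. ?a k * (q * z) ^ k) sums ?F (q * z)"
    unfolding q_binomial_series_def by (rule summable_sums[OF summable_q_binomial_series[OF q qz]])
  have "(\<lambda>k. ?a k * z ^ k - ?a k * (q * z) ^ k) sums (?F z - ?F (q * z))"
    by (intro sums_diff F G)
  \<comment> \<open>The constant terms of the two series cancel.\<close>
  then have "(\<lambda>k. ?a (Suc k) * z ^ Suc k - ?a (Suc k) * (q * z) ^ Suc k) sums (?F z - ?F (q * z))"
    by (subst sums_Suc_iff) simp
  moreover have "?a (Suc k) * z ^ Suc k - ?a (Suc k) * (q * z) ^ Suc k
      = u * z * (?a k * z ^ k) - c * z * (?a k * (q * z) ^ k)" for k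
  proof -
    have "?a (Suc k) * z ^ Suc k - ?a (Suc k) * (q * z) ^ Suc k
        = (?a (Suc k) * (1 - q ^ Suc k)) * z ^ Suc k"
      by (simp add: power_mult_distrib algebra_simps)
    also have "\<dots> = (u - c * q ^ k) * ?a k * z ^ Suc k"
      by (simp only: q_binomial_coeff_Suc[OF q])
    finally show ?thesis by (simp add: power_mult_distrib algebra_simps)
  qed
  ultimately have "(\<lambda>k. u * z * (?a k * z ^ k) - c * z * (?a k * (q * z) ^ k)) sums (?F z - ?F (q * z))"
    by simp
  moreover have "(\<lambda>k. u * z * (?a k * z ^ k) - c * z * (?a k * (q * z) ^ k))
      sums (u * z * ?F z - c * z * ?F (q * z))"
    by (intro sums_diff sums_mult F G)
  ultimately have "?F z - ?F (q * z) = u * z * ?F z - c * z * ?F (q * z)"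
    by (rule sums_unique2)
  then show ?thesis by (simp add: algebra_simps)
qed

lemma q_binomial_series_iterate:
  assumes q: "0 < q" "q < 1" and u: "\<bar>u\<bar> < 1"
  shows "q_pochhammer u q s * q_binomial_series q u c 1 = q_pochhammer c q s * q_binomial_series q u c (q ^ s)"
proof (induction s)
  case (Suc s)
  have "\<bar>u * q ^ s\<bar> \<le> \<bar>u\<bar>"
    using q by (simp add: abs_mult mult_left_le power_le_one)
  then have "(1 - u * q ^ s) * q_binomial_series q u c (q ^ s)
      = (1 - c * q ^ s) * q_binomial_series q u c (q ^ Suc s)"
    using q_binomial_series_functional_eq[OF q, of u "q ^ s" c] u by simp
  then show ?case
    using Suc.IH by (simp add: q_pochhammer_Suc) (metis mult.assoc mult.commute)
qed simp

theorem q_binomial_theorem: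
  assumes q: "0 < q" "q < 1" and u: "\<bar>u\<bar> < 1"
  shows "q_binomial_series q u c 1 = q_pochhammer_inf c q / q_pochhammer_inf u q"
proof -
  let ?F = "q_binomial_series q u c"
  have sums: "(\<lambda>k. q_binomial_coeff q u c k * z ^ k) sums ?F z" if "norm z < 1" for z
    unfolding q_binomial_series_def
  proof (intro summable_sums summable_q_binomial_series q)
    show "\<bar>u * z\<bar> < 1"
      using u that mult_strict_mono'[of "\<bar>u\<bar>" 1 "\<bar>z\<bar>" 1] by (simp add: abs_mult)
  qed
  have "(?F \<longlongrightarrow> q_binomial_coeff q u c 0) (at 0)"
    by (rule powser_limit_0[of 1, OF _ sums]) auto
  moreover have "filterlim (\<lambda>n. q ^ n) (at 0) sequentially"
    using q LIMSEQ_power_zero[of q] by (auto simp: filterlim_at)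
  ultimately have "(\<lambda>n. ?F (q ^ n)) \<longlonglongrightarrow> 1"
    using filterlim_compose by force
  then have "(\<lambda>n. q_pochhammer c q n * ?F (q ^ n)) \<longlonglongrightarrow> q_pochhammer_inf c q * 1"
    by (intro tendsto_mult q_pochhammer_LIMSEQ[OF q])
  moreover have "(\<lambda>n. q_pochhammer u q n * ?F 1) \<longlonglongrightarrow> q_pochhammer_inf u q * ?F 1"
    by (intro tendsto_intros q_pochhammer_LIMSEQ[OF q])
  ultimately have "q_pochhammer_inf u q * ?F 1 = q_pochhammer_inf c q"
    unfolding q_binomial_series_iterate[OF q u] using LIMSEQ_unique by fastforce
  moreover have "q_pochhammer_inf u q \<noteq> 0"
    using u by (intro q_pochhammer_inf_nonzero q) auto
  ultimately show ?thesis by (simp add: field_simps)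
qed

lemma stancu_basis_eq_q_binomial_coeff:
  assumes "0 < q" "q < 1" "0 \<le> \<alpha>" and \<gamma>: "\<gamma> = \<alpha> / (1 - q)"
  shows "stancu_basis q \<alpha> k x = q_binomial_coeff q ((x + \<gamma>) / (1 + \<gamma>)) (\<gamma> / (1 + \<gamma>)) k *
    (q_pochhammer_inf ((x + \<gamma>) / (1 + \<gamma>)) q / q_pochhammer_inf (\<gamma> / (1 + \<gamma>)) q)"
proof -
  have "(\<Prod>i<k. x + \<gamma> - \<gamma> * q ^ i) / (1 + \<gamma>) ^ k = (\<Prod>i<k. (x + \<gamma> - \<gamma> * q ^ i) / (1 + \<gamma>))"
    by (simp add: prod_dividef)
  also have "\<dots> = (\<Prod>i<k. (x + \<gamma>) / (1 + \<gamma>) - \<gamma> / (1 + \<gamma>) * q ^ i)"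
    by (simp add: diff_divide_distrib)
  finally have numerator: "(\<Prod>i<k. x + \<gamma> - \<gamma> * q ^ i) / (1 + \<gamma>) ^ k =
    (\<Prod>i<k. (x + \<gamma>) / (1 + \<gamma>) - \<gamma> / (1 + \<gamma>) * q ^ i)" .
  show ?thesis
    unfolding stancu_basis_def q_binomial_coeff_def Let_def \<gamma>[symmetric] numerator by simp
qed

text \<open>
  Since \<open>q ^ k = 1 - t\<close> at the node \<open>t = 1 - q ^ k\<close>, this evaluates the operator on \<open>t \<mapsto> (1 - t) ^ s\<close>.
  The factor \<open>(q ^ k) ^ s = (q ^ s) ^ k\<close> only moves the argument of the \<open>q\<close>-binomial series from
  \<open>1\<close> to \<open>q ^ s\<close>, and \<open>q_binomial_series_iterate\<close> compares the values at these two points.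
\<close>
lemma stancu_basis_power_sums:
  assumes q: "0 < q" "q < 1" and "0 \<le> \<alpha>" and \<gamma>: "\<gamma> = \<alpha> / (1 - q)" and x: "0 \<le> x" "x < 1"
  shows "(\<lambda>k. (q ^ k) ^ s * stancu_basis q \<alpha> k x) sums
    (q_pochhammer ((x + \<gamma>) / (1 + \<gamma>)) q s / q_pochhammer (\<gamma> / (1 + \<gamma>)) q s)"
proof -
  define u where "u = (x + \<gamma>) / (1 + \<gamma>)"
  define c where "c = \<gamma> / (1 + \<gamma>)"
  have "\<gamma> \<ge> 0" using assms by simp
  then have u: "\<bar>u\<bar> < 1" and c: "c < 1"
    using x by (auto simp: u_def c_def)
  have nz: "q_pochhammer_inf u q \<noteq> 0" "q_pochhammer_inf c q \<noteq> 0" "q_pochhammer c q s \<noteq> 0"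
    using u c q_pochhammer_pos[OF q c, of s] by (auto simp: q_pochhammer_inf_nonzero[OF q])
  have "\<bar>u * q ^ s\<bar> \<le> \<bar>u\<bar>"
    using q by (simp add: abs_mult mult_left_le power_le_one)
  then have "(\<lambda>k. q_binomial_coeff q u c k * (q ^ s) ^ k) sums q_binomial_series q u c (q ^ s)"
    unfolding q_binomial_series_def using u
    by (intro summable_sums summable_q_binomial_series q) simp
  then have "(\<lambda>k. q_binomial_coeff q u c k * (q ^ s) ^ k * (q_pochhammer_inf u q / q_pochhammer_inf c q))
      sums (q_binomial_series q u c (q ^ s) * (q_pochhammer_inf u q / q_pochhammer_inf c q))"
    by (rule sums_mult2)
  moreover have "q_binomial_series q u c (q ^ s) * (q_pochhammer_inf u q / q_pochhammer_inf c q)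
      = q_pochhammer u q s / q_pochhammer c q s"
    using q_binomial_series_iterate[OF q u, of s c] nz
    unfolding q_binomial_theorem[OF q u] by (simp add: field_simps)
  moreover have "q_binomial_coeff q u c k * (q ^ s) ^ k * (q_pochhammer_inf u q / q_pochhammer_inf c q)
      = (q ^ k) ^ s * stancu_basis q \<alpha> k x" for k
    unfolding stancu_basis_eq_q_binomial_coeff[OF assms(1-4)] u_def[symmetric] c_def[symmetric]
    by (simp add: power_mult[symmetric] mult.commute)
  ultimately show ?thesis by (simp add: u_def c_def)
qed

theorem theorem3p9:
  fixes q \<alpha> \<gamma> x :: real and m :: nat
  assumes "0 < q" and "q < 1" and "0 \<le> \<alpha>"
    and "\<gamma> = \<alpha> / (1 - q)"
    and "x \<in> {0..1}"
  shows "limit_q_stancu q \<alpha> (\<lambda>t. t ^ m) x =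
    (\<Sum>s=0..m. real (m choose s) * (-1) ^ s *
       (q_pochhammer ((x + \<gamma>) / (1 + \<gamma>)) q s / q_pochhammer (\<gamma> / (1 + \<gamma>)) q s))"
proof (cases "x = 1")
  case True
  have "\<gamma> \<ge> 0" using assms by simp
  then have "(x + \<gamma>) / (1 + \<gamma>) = 1" using True by simp
  then have "(\<Sum>s=0..m. real (m choose s) * (-1) ^ s *
       (q_pochhammer ((x + \<gamma>) / (1 + \<gamma>)) q s / q_pochhammer (\<gamma> / (1 + \<gamma>)) q s)) = 1"
    by (simp add: sum.atLeast_Suc_atMost q_pochhammer_one_left)
  then show ?thesis using True by (simp add: limit_q_stancu_def)
next
  case False
  then have x: "0 \<le> x" "x < 1" using assms by auto
  have expand: "(1 - q ^ k) ^ m = (\<Sum>s=0..m. real (m choose s) * (-1) ^ s * (q ^ k) ^ s)" for k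
    using binomial_ring[of "- (q ^ k)" 1 m] power_minus[of "q ^ k"]
    by (simp add: atMost_atLeast0 mult.assoc)
  have "(\<lambda>k. \<Sum>s=0..m. real (m choose s) * (-1) ^ s * ((q ^ k) ^ s * stancu_basis q \<alpha> k x)) sums
    (\<Sum>s=0..m. real (m choose s) * (-1) ^ s *
       (q_pochhammer ((x + \<gamma>) / (1 + \<gamma>)) q s / q_pochhammer (\<gamma> / (1 + \<gamma>)) q s))"
    by (intro sums_sum sums_mult stancu_basis_power_sums assms x)
  then have "(\<lambda>k. (1 - q ^ k) ^ m * stancu_basis q \<alpha> k x) sums
    (\<Sum>s=0..m. real (m choose s) * (-1) ^ s *
       (q_pochhammer ((x + \<gamma>) / (1 + \<gamma>)) q s / q_pochhammer (\<gamma> / (1 + \<gamma>)) q s))"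
    unfolding expand sum_distrib_right by (simp add: mult.assoc)
  then show ?thesis
    using False by (simp add: limit_q_stancu_def sums_unique[symmetric])
qed

end
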